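(* Let $A$ be a skew left brace with multiplicative group $(A,\circ)$ isomorphic to $\mathbb{Z}$. Then $A$ has finite multipermutation level if and only if $A$ is of abelian type, i.e. the additive group $(A,+)$ is abelian.
   Context: A skew left brace is a triple $(A,+,\circ)$ where $(A,+)$ and $(A,\circ)$ are (not necessarily abelian) groups such that $a\circ(b+c)=a\circ b-a+a\circ c$ for all $a,b,c\in A$. $(A,+)$ is called the additive group and $(A,\circ)$ the multiplicative group. The socle of $A$ is $\mathrm{Soc}(A)=\{x\in A: x\circ a=x+a \text{ and } x+a=a+x \text{ for all } a\in A\}$; it is an ideal of $A$ (a subset that is a normal subgroup of both $(A,+)$ and $(A,\circ)$ and is stable under all maps $b\mapsto -a+a\circ b$, $a\in A$), so the quotient $A/\mathrm{Soc}(A)$ is a skew left brace. $A$ has finite multipermutation level if the sequence defined by $S_1=A$ and $S_{n+1}=S_n/\mathrm{Soc}(S_n)$ for $n\ge 1$ reaches zero, i.e. $S_n=0$ for some $n$. *)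

theory Defs
  imports "HOL-Algebra.Algebra"
begin

text \<open>
  A skew left brace is carried by the library record \<open>ring\<close>: the fields \<open>add\<close>, \<open>zero\<close> hold the
  additive group (not assumed commutative) and \<open>mult\<close>, \<open>one\<close> the multiplicative group, so
  \<open>\<otimes>\<close> is the circle operation. A ring record, read as a monoid, is its multiplicative structure.
\<close>

locale skew_left_brace =
  fixes A (structure)
  assumes additive_group: "group (add_monoid A)"
    and multiplicative_group: "group A"
    and circle_add: "\<lbrakk>a \<in> carrier A; b \<in> carrier A; c \<in> carrier A\<rbrakk>
      \<Longrightarrow> a \<otimes> (b \<oplus> c) = a \<otimes> b \<ominus> a \<oplus> a \<otimes> c"

definition socle :: "('a, 'm) ring_scheme \<Rightarrow> 'a set" where
  "socle A = {x \<in> carrier A. \<forall>a \<in> carrier A.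
     x \<otimes>\<^bsub>A\<^esub> a = x \<oplus>\<^bsub>A\<^esub> a \<and> x \<oplus>\<^bsub>A\<^esub> a = a \<oplus>\<^bsub>A\<^esub> x}"

definition brace_ideal :: "'a set \<Rightarrow> ('a, 'm) ring_scheme \<Rightarrow> bool" where
  "brace_ideal I A \<longleftrightarrow> I \<lhd> add_monoid A \<and> I \<lhd> A \<and>
     (\<forall>a \<in> carrier A. \<forall>b \<in> I. \<ominus>\<^bsub>A\<^esub> a \<oplus>\<^bsub>A\<^esub> a \<otimes>\<^bsub>A\<^esub> b \<in> I)"

text \<open>
  The quotient by an ideal is the library's \<open>A Quot I\<close>, whose definition uses no ring axioms: its
  elements are the additive cosets, with the induced operations. It lives on the type of sets, so
  to iterate \<open>A \<mapsto> A / Soc(A)\<close> within one type it is transported along the choice of a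
  representative from each coset. The lemmas below show that the socle is an ideal, that the
  quotient is a skew left brace, and that the transport is an isomorphic copy of it.
\<close>

definition socle_quotient :: "'a ring \<Rightarrow> 'a ring" where
  "socle_quotient A = image_ring (\<lambda>K. SOME x. x \<in> K) (A Quot socle A)"

text \<open>Indexed from 0: \<open>socle_series A n\<close> is $S_{n+1}$.\<close>

primrec socle_series :: "'a ring \<Rightarrow> nat \<Rightarrow> 'a ring" where
  "socle_series A 0 = A"
| "socle_series A (Suc n) = socle_quotient (socle_series A n)"

definition finite_multipermutation_level :: "'a ring \<Rightarrow> bool" where
  "finite_multipermutation_level A \<longleftrightarrow>
     (\<exists>n. carrier (socle_series A n) = {\<zero>\<^bsub>socle_series A n\<^esub>})"

definition abelian_type :: "('a, 'm) ring_scheme \<Rightarrow> bool" where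
  "abelian_type A \<longleftrightarrow> comm_group (add_monoid A)"

context skew_left_brace
begin

sublocale add: group "add_monoid A"
  rewrites "carrier (add_monoid A) = carrier A"
    and "monoid.mult (add_monoid A) = (\<oplus>)"
    and "monoid.one (add_monoid A) = \<zero>"
    and "m_inv (add_monoid A) = a_inv A"
  by (rule additive_group) (auto simp: a_inv_def)

sublocale circ: group A
  by (rule multiplicative_group)

lemma add_cancel_right: "\<lbrakk>x \<in> carrier A; y \<in> carrier A\<rbrakk> \<Longrightarrow> x \<oplus> y \<ominus> y = x"
  by (simp add: a_minus_def add.m_assoc)

lemma one_eq_zero: "\<one> = \<zero>"
proof -
  have "\<one> \<otimes> (\<zero> \<oplus> \<zero>) = \<one> \<otimes> \<zero> \<ominus> \<one> \<oplus> \<one> \<otimes> \<zero>" by (rule circle_add) auto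
  then have "\<zero> = \<ominus> \<one>" by (simp add: a_minus_def)
  then show ?thesis by (metis add.inv_inv add.inv_one circ.one_closed)
qed

definition lam :: "'a \<Rightarrow> 'a \<Rightarrow> 'a" where "lam a b = \<ominus> a \<oplus> a \<otimes> b"

lemma lam_closed [simp]: "\<lbrakk>a \<in> carrier A; b \<in> carrier A\<rbrakk> \<Longrightarrow> lam a b \<in> carrier A"
  by (simp add: lam_def)

lemma circle_lam: "\<lbrakk>a \<in> carrier A; b \<in> carrier A\<rbrakk> \<Longrightarrow> a \<otimes> b = a \<oplus> lam a b"
  by (simp add: lam_def add.m_assoc[symmetric])

lemma lam_add: "\<lbrakk>a \<in> carrier A; b \<in> carrier A; c \<in> carrier A\<rbrakk>
    \<Longrightarrow> lam a (b \<oplus> c) = lam a b \<oplus> lam a c"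
  by (simp add: lam_def circle_add a_minus_def add.m_assoc)

lemma lam_circle: 
  assumes "a \<in> carrier A" "b \<in> carrier A" "c \<in> carrier A"
  shows "lam (a \<otimes> b) c = lam a (lam b c)"
proof -
  have "a \<oplus> (lam a b \<oplus> lam (a \<otimes> b) c) = (a \<otimes> b) \<otimes> c"
    using assms circle_lam[of "a \<otimes> b" c] circle_lam[of a b]
    by (metis add.m_assoc lam_closed circ.m_closed)
  also have "\<dots> = a \<otimes> (b \<oplus> lam b c)" using assms by (simp add: circ.m_assoc circle_lam[of b c])
  also have "\<dots> = a \<oplus> (lam a b \<oplus> lam a (lam b c))"
    using assms by (simp add: circle_lam[of a] lam_add)
  finally show ?thesis using assms by simp
qed

lemma lam_one: "b \<in> carrier A \<Longrightarrow> lam \<one> b = b"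
  by (simp add: lam_def) (simp add: one_eq_zero)

lemma lam_inv: "\<lbrakk>a \<in> carrier A; b \<in> carrier A\<rbrakk> \<Longrightarrow> lam a (lam (inv a) b) = b"
  "\<lbrakk>a \<in> carrier A; b \<in> carrier A\<rbrakk> \<Longrightarrow> lam (inv a) (lam a b) = b"
  by (simp_all add: lam_circle[symmetric] lam_one)

lemma socle_iff: "x \<in> socle A \<longleftrightarrow> x \<in> carrier A \<and>
    (\<forall>a \<in> carrier A. lam x a = a \<and> x \<oplus> a = a \<oplus> x)"
  unfolding socle_def by (auto simp: circle_lam)

lemma socle_circle: "\<lbrakk>x \<in> socle A; a \<in> carrier A\<rbrakk> \<Longrightarrow> x \<otimes> a = x \<oplus> a"
  by (simp add: socle_def)

lemma socle_conj:
  assumes x: "x \<in> socle A" and a: "a \<in> carrier A"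
  shows "a \<otimes> x \<otimes> inv a = lam a x" and "lam a x \<in> socle A"
proof -
  have xc: "x \<in> carrier A" using x by (simp add: socle_iff)
  have central: "lam a x \<oplus> b = b \<oplus> lam a x" if b: "b \<in> carrier A" for b
  proof -
    have "x \<oplus> lam (inv a) b = lam (inv a) b \<oplus> x" using x a b by (simp add: socle_iff)
    then have "lam a (x \<oplus> lam (inv a) b) = lam a (lam (inv a) b \<oplus> x)" by simp
    then show ?thesis using a b xc by (simp add: lam_add lam_inv)
  qed
  have "a \<otimes> x \<otimes> inv a = a \<otimes> (x \<oplus> inv a)"
    using x a xc by (simp add: circ.m_assoc socle_circle)
  also have "\<dots> = a \<oplus> (lam a x \<oplus> lam a (inv a))"
    using a xc by (simp add: circle_lam[of a] lam_add)
  also have "\<dots> = a \<oplus> (lam a (inv a) \<oplus> lam a x)"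
    using a xc central by simp
  also have "\<dots> = a \<otimes> inv a \<oplus> lam a x"
    using a xc by (simp only: circle_lam[of a "inv a"] add.m_assoc circ.inv_closed lam_closed)
  also have "\<dots> = lam a x"
    using a xc by (simp add: one_eq_zero)
  finally show eq: "a \<otimes> x \<otimes> inv a = lam a x" .
  have "lam (lam a x) b = b" if b: "b \<in> carrier A" for b
  proof -
    have "lam (lam a x) b = lam a (lam x (lam (inv a) b))"
      using a b xc by (simp add: eq[symmetric] lam_circle)
    then show ?thesis using x a b by (simp add: socle_iff lam_inv)
  qed
  then show "lam a x \<in> socle A" using central a xc by (simp add: socle_iff)
qed

lemma socle_subgroup_add: "subgroup (socle A) (add_monoid A)"
proof (rule add.subgroupI)
  show "socle A \<subseteq> carrier A" by (auto simp: socle_def)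
  have "\<zero> \<in> socle A" by (simp add: socle_iff lam_one one_eq_zero[symmetric]) (simp add: one_eq_zero)
  then show "socle A \<noteq> {}" by auto
next
  fix x assume x: "x \<in> socle A"
  then have xc: "x \<in> carrier A" by (simp add: socle_iff)
  have "x \<otimes> (\<ominus> x) = \<one>" using x xc by (simp add: socle_circle one_eq_zero)
  then have eq: "inv x = \<ominus> x" using xc by (metis add.inv_closed circ.inv_equality circ.inv_inv)
  have "lam (\<ominus> x) a = a" if "a \<in> carrier A" for a
    using lam_inv(2)[OF xc that] x that by (simp add: eq socle_iff)
  moreover have "\<ominus> x \<oplus> a = a \<oplus> \<ominus> x" if a: "a \<in> carrier A" for a
  proof -
    have "x \<oplus> (\<ominus> a) = \<ominus> a \<oplus> x" using x a by (simp add: socle_iff)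
    then have "\<ominus> (x \<oplus> (\<ominus> a)) = \<ominus> (\<ominus> a \<oplus> x)" by simp
    then show ?thesis using xc a by (simp add: add.inv_mult_group)
  qed
  ultimately show "\<ominus> x \<in> socle A" using xc by (simp add: socle_iff)
next
  fix x y assume x: "x \<in> socle A" and y: "y \<in> socle A"
  then have c: "x \<in> carrier A" "y \<in> carrier A" by (simp_all add: socle_iff)
  have "lam (x \<oplus> y) a = a" if "a \<in> carrier A" for a
    using that c x y by (simp add: socle_circle[symmetric] lam_circle) (simp add: socle_iff)
  moreover have "x \<oplus> y \<oplus> a = a \<oplus> (x \<oplus> y)" if "a \<in> carrier A" for a
    using that c x y by (metis add.m_assoc socle_iff)
  ultimately show "x \<oplus> y \<in> socle A" using c by (simp add: socle_iff)
qed

lemma socle_ideal: "brace_ideal (socle A) A"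
  unfolding brace_ideal_def
proof (intro conjI ballI)
  interpret S: subgroup "socle A" "add_monoid A" by (rule socle_subgroup_add)
  have c: "x \<in> socle A \<Longrightarrow> x \<in> carrier A" for x by (simp add: socle_iff)
  show "socle A \<lhd> add_monoid A"
    unfolding group.normal_inv_iff[OF additive_group]
  proof (intro conjI ballI socle_subgroup_add)
    fix a x assume "a \<in> carrier (add_monoid A)" and x: "x \<in> socle A"
    then have a: "a \<in> carrier A" by simp
    have "a \<oplus> x \<oplus> (\<ominus> a) = x \<oplus> (a \<oplus> (\<ominus> a))"
      using x a c[OF x] by (metis add.m_assoc add.inv_closed socle_iff)
    then have "a \<oplus> x \<oplus> (\<ominus> a) = x" using a c[OF x] by simp
    then show "a \<otimes>\<^bsub>add_monoid A\<^esub> x \<otimes>\<^bsub>add_monoid A\<^esub> inv\<^bsub>add_monoid A\<^esub> a \<in> socle A"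
      using x by (simp add: a_inv_def[symmetric])
  qed
  show "socle A \<lhd> A"
    unfolding circ.normal_inv_iff
  proof (intro conjI ballI circ.subgroupI)
    show "socle A \<subseteq> carrier A" using c by auto
    show "socle A \<noteq> {}" using S.one_closed by auto
    fix x assume x: "x \<in> socle A"
    have m: "\<ominus> x \<in> socle A" using S.m_inv_closed[OF x] by (simp add: a_inv_def)
    have "x \<otimes> (\<ominus> x) = \<one>" using x c[OF x] by (simp add: socle_circle one_eq_zero)
    then have "inv x = \<ominus> x" using c[OF x] c[OF m] by (metis circ.inv_equality circ.inv_inv)
    then show "inv x \<in> socle A" using m by simp
  next
    fix x y assume "x \<in> socle A" "y \<in> socle A"
    then show "x \<otimes> y \<in> socle A" using S.m_closed by (simp add: socle_circle c)
  next
    fix a x assume "a \<in> carrier A" "x \<in> socle A"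
    then show "a \<otimes> x \<otimes> inv a \<in> socle A" by (simp add: socle_conj)
  qed
  fix a x assume "a \<in> carrier A" "x \<in> socle A"
  then show "\<ominus> a \<oplus> a \<otimes> x \<in> socle A" using socle_conj(2) by (simp add: lam_def)
qed

end

lemma group_hom_imageI:
  assumes "group G" and "h ` carrier G = carrier H" and "h \<one>\<^bsub>G\<^esub> = \<one>\<^bsub>H\<^esub>"
    and "\<And>x y. \<lbrakk>x \<in> carrier G; y \<in> carrier G\<rbrakk> \<Longrightarrow> h (x \<otimes>\<^bsub>G\<^esub> y) = h x \<otimes>\<^bsub>H\<^esub> h y"
  shows "group H"
proof -
  interpret group G by fact
  note ass = assms(2)[symmetric] assms(3)[symmetric] assms(4)[symmetric]
  show ?thesis
  proof (rule groupI)
    fix x assume "x \<in> carrier H"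
    then obtain u where u: "u \<in> carrier G" "x = h u" by (auto simp: ass(1))
    then have "h (inv\<^bsub>G\<^esub> u) \<otimes>\<^bsub>H\<^esub> x = \<one>\<^bsub>H\<^esub>" by (simp add: ass(2,3))
    then show "\<exists>y\<in>carrier H. y \<otimes>\<^bsub>H\<^esub> x = \<one>\<^bsub>H\<^esub>" using u by (auto simp: ass(1))
  qed (auto simp: ass m_assoc)
qed

text \<open>A surjective map compatible with all operations carries the brace structure over.\<close>

lemma (in skew_left_brace) skew_left_brace_imageI:
  assumes im: "h ` carrier A = carrier B"
    and z: "h \<zero> = \<zero>\<^bsub>B\<^esub>" and o: "h \<one> = \<one>\<^bsub>B\<^esub>"
    and p: "\<And>x y. \<lbrakk>x \<in> carrier A; y \<in> carrier A\<rbrakk> \<Longrightarrow> h (x \<oplus> y) = h x \<oplus>\<^bsub>B\<^esub> h y"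
    and t: "\<And>x y. \<lbrakk>x \<in> carrier A; y \<in> carrier A\<rbrakk> \<Longrightarrow> h (x \<otimes> y) = h x \<otimes>\<^bsub>B\<^esub> h y"
  shows "skew_left_brace B"
proof -
  have g: "group (add_monoid B)"
    by (rule group_hom_imageI[OF additive_group, of h]) (simp_all add: im z p)
  interpret B: group "add_monoid B" by (rule g)
  have mi: "h (\<ominus> x) = \<ominus>\<^bsub>B\<^esub> h x" if x: "x \<in> carrier A" for x
  proof -
    have "h (\<ominus> x) \<oplus>\<^bsub>B\<^esub> h x = \<zero>\<^bsub>B\<^esub>" using x by (simp add: p[symmetric] z)
    then show ?thesis unfolding a_inv_def[of B]
      using B.inv_equality[of "h (\<ominus> x)" "h x"] x im by fastforce
  qed
  show ?thesis
  proof (rule skew_left_brace.intro)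
    show "group (add_monoid B)" by (rule g)
    show "group B" by (rule group_hom_imageI[OF multiplicative_group, of h]) (simp_all add: im o t)
    fix a b c assume "a \<in> carrier B" "b \<in> carrier B" "c \<in> carrier B"
    then obtain u v w where c: "u \<in> carrier A" "v \<in> carrier A" "w \<in> carrier A"
      and e: "a = h u" "b = h v" "c = h w" by (auto simp: im[symmetric])
    have "h (u \<otimes> (v \<oplus> w)) = h (u \<otimes> v \<ominus> u \<oplus> u \<otimes> w)" using circle_add c by simp
    then show "a \<otimes>\<^bsub>B\<^esub> (b \<oplus>\<^bsub>B\<^esub> c) = a \<otimes>\<^bsub>B\<^esub> b \<ominus>\<^bsub>B\<^esub> a \<oplus>\<^bsub>B\<^esub> a \<otimes>\<^bsub>B\<^esub> c"
      using c by (simp add: e a_minus_def p t mi)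
  qed
qed

context skew_left_brace
begin

lemma coset_circle:
  assumes I: "brace_ideal I A" and x: "x \<in> carrier A" and y: "y \<in> carrier A"
  shows "rcoset_mult A I (I +> x) (I +> y) = I +> (x \<otimes> y)"
proof -
  interpret N: normal I "add_monoid A" using I by (simp add: brace_ideal_def)
  interpret M: normal I A using I by (simp add: brace_ideal_def)
  have ic: "i \<in> I \<Longrightarrow> i \<in> carrier A" for i using M.subset by auto
  have lamI: "lam a i \<in> I" if "a \<in> carrier A" "i \<in> I" for a i
    using I that by (simp add: brace_ideal_def lam_def)
  have mem: "u \<in> I +> v \<longleftrightarrow> (\<exists>i\<in>I. u = i \<oplus> v)" for u v
    by (auto simp: a_r_coset_def r_coset_def)
  have left: "I +> v = (\<lambda>i. v \<oplus> i) ` I" if v: "v \<in> carrier A" for v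
    using N.coset_eq v by (auto simp: a_r_coset_def r_coset_def l_coset_def)
  have circ: "I +> v = (\<lambda>i. v \<otimes> i) ` I" if v: "v \<in> carrier A" for v
  proof -
    have "(\<lambda>i. v \<oplus> i) ` I = (\<lambda>i. v \<otimes> i) ` I"
    proof (intro equalityI image_subsetI)
      fix i assume i: "i \<in> I"
      have "v \<oplus> i = v \<otimes> lam (inv v) i" using v ic[OF i] by (simp add: circle_lam[of v] lam_inv)
      then show "v \<oplus> i \<in> (\<lambda>i. v \<otimes> i) ` I" using lamI[of "inv v" i] v i by auto
      have "v \<otimes> i = v \<oplus> lam v i" using v ic[OF i] by (simp add: circle_lam[of v])
      then show "v \<otimes> i \<in> (\<lambda>i. v \<oplus> i) ` I" using lamI[of v i] v i by auto
    qed
    then show ?thesis using left v by simp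
  qed
  have co: "I +> v = v <#\<^bsub>A\<^esub> I" if "v \<in> carrier A" for v
    using circ that by (auto simp: l_coset_def)
  have eq: "I +> (a \<otimes> b) = I +> (x \<otimes> y)" if a: "a \<in> I +> x" and b: "b \<in> I +> y" for a b
  proof -
    have c: "a \<in> carrier A" "b \<in> carrier A" using a b x y ic by (auto simp: mem)
    have "a <#\<^bsub>A\<^esub> I = x <#\<^bsub>A\<^esub> I" "b <#\<^bsub>A\<^esub> I = y <#\<^bsub>A\<^esub> I"
      using a b x y circ.l_repr_independence[OF _ _ M.subgroup_axioms] by (metis co)+
    then have "I #>\<^bsub>A\<^esub> a = I #>\<^bsub>A\<^esub> x" "I #>\<^bsub>A\<^esub> b = I #>\<^bsub>A\<^esub> y"
      using x y c M.coset_eq by auto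
    then have "I #>\<^bsub>A\<^esub> (a \<otimes> b) = I #>\<^bsub>A\<^esub> (x \<otimes> y)"
      using x y c by (metis M.rcos_sum)
    then show ?thesis using x y c M.coset_eq by (simp add: co)
  qed
  have "\<zero> \<in> I" using N.one_closed by simp
  then have "x \<in> I +> x" "y \<in> I +> y" using x y by (auto simp: mem intro!: bexI[of _ \<zero>])
  then show ?thesis unfolding rcoset_mult_def using eq by blast
qed

lemma quotient_brace:
  assumes I: "brace_ideal I A"
  shows "skew_left_brace (A Quot I)"
proof (rule skew_left_brace_imageI[of "\<lambda>x. I +> x"])
  interpret N: normal I "add_monoid A" using I by (simp add: brace_ideal_def)
  show "(+>) I ` carrier A = carrier (A Quot I)"
    by (auto simp: FactRing_def A_RCOSETS_def RCOSETS_def a_r_coset_def)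
  show "I +> \<zero> = \<zero>\<^bsub>A Quot I\<^esub>"
    using add.coset_mult_one[OF N.subset[simplified]] by (simp add: FactRing_def a_r_coset_def)
  show "I +> \<one> = \<one>\<^bsub>A Quot I\<^esub>" by (simp add: FactRing_def)
  fix x y assume c: "x \<in> carrier A" "y \<in> carrier A"
  show "I +> (x \<oplus> y) = (I +> x) \<oplus>\<^bsub>A Quot I\<^esub> (I +> y)"
    using c N.rcos_sum[of x y] by (simp add: FactRing_def a_r_coset_def set_add_def)
  show "I +> (x \<otimes> y) = (I +> x) \<otimes>\<^bsub>A Quot I\<^esub> (I +> y)"
    using c I by (simp add: FactRing_def coset_circle)
qed

lemma representative_inj:
  assumes I: "brace_ideal I A"
  shows "inj_on (\<lambda>K. SOME x. x \<in> K) (carrier (A Quot I))"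
proof (rule inj_onI)
  interpret N: normal I "add_monoid A" using I by (simp add: brace_ideal_def)
  fix K L assume "K \<in> carrier (A Quot I)" "L \<in> carrier (A Quot I)"
    and eq: "(SOME x. x \<in> K) = (SOME x. x \<in> L)"
  then have K: "K \<in> rcosets\<^bsub>add_monoid A\<^esub> I" and L: "L \<in> rcosets\<^bsub>add_monoid A\<^esub> I"
    by (simp_all add: FactRing_def A_RCOSETS_def)
  have ne: "K \<noteq> {}" "L \<noteq> {}"
    using K L N.rcosets_non_empty by auto
  then have "(SOME x. x \<in> K) \<in> K" "(SOME x. x \<in> K) \<in> L"
    unfolding some_in_eq using eq by (metis some_in_eq)+
  then show "K = L"
    using group.rcos_disjoint[OF additive_group N.subgroup_axioms] K L
    by (auto simp: pairwise_def disjnt_def)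
qed

end

lemma socle_quotient_iso:
  assumes "skew_left_brace A"
  shows "skew_left_brace (socle_quotient A)"
    and "(\<lambda>K. SOME x. x \<in> K) \<in> ring_iso (A Quot socle A) (socle_quotient A)"
proof -
  interpret skew_left_brace A by fact
  interpret Q: skew_left_brace "A Quot socle A" by (rule quotient_brace[OF socle_ideal])
  show iso: "(\<lambda>K. SOME x. x \<in> K) \<in> ring_iso (A Quot socle A) (socle_quotient A)"
    unfolding socle_quotient_def
    by (rule inj_imp_image_ring_iso[OF representative_inj[OF socle_ideal]])
  show "skew_left_brace (socle_quotient A)"
    by (rule Q.skew_left_brace_imageI[of "\<lambda>K. SOME x. x \<in> K"])
      (use iso in \<open>auto simp: ring_iso_def ring_hom_def bij_betw_def socle_quotient_def
         image_ring_zero\<close>)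
qed

lemma socle_series_brace: "skew_left_brace A \<Longrightarrow> skew_left_brace (socle_series A n)"
  by (induction n) (simp_all add: socle_quotient_iso)

end

theory Submission
  imports Defs
begin

text \<open>
  Transport the brace to the integers, so that the circle operation becomes \<open>+\<close>.

  If the level is finite, then the socle contains some \<open>n > 0\<close>, so the additive group has a central
  subgroup \<open>n\<int>\<close> of finite index. The transfer is an additive homomorphism which kills commutators and
  is injective on \<open>n\<int>\<close>. The elements whose whole \<open>lam\<close>-orbit is killed by it form a subgroup under
  \<open>+\<close> that meets \<open>n\<int>\<close> trivially, hence is zero; it contains the commutators.

  Conversely, let the additive group be abelian and put \<open>T = lam 1\<close>. The additive group is a cyclic
  module \<open>R\<close> over \<open>\<int>[T, T\<^sup>-\<^sup>1]\<close>, generated by \<open>1\<close>, and \<open>1 + (1 - T) R\<close> is the orbit of \<open>1\<close> under \<open>T\<close>.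
  If no positive integer lies in \<open>(1 - T) R\<close>, then counting modulo \<open>(1 - T) R\<close> gives \<open>T = 1\<close>, and the
  brace is trivial. Otherwise, for some \<open>d > 0\<close>, both \<open>1 + d\<close> and \<open>1 + 2d\<close> are powers of \<open>T\<close> in \<open>R\<close>, and
  as these integers are coprime, \<open>R\<close> has positive characteristic. Now \<open>1 - T + T\<^sup>2\<close> is a power of
  \<open>T\<close> as well, so finitely many powers of \<open>T\<close> span \<open>R\<close>, which is therefore finite: a contradiction.
\<close>

section \<open>Skew left braces on the integers with circle operation +\<close>

locale integer_brace = skew_left_brace B for B :: "int ring" (structure) +
  assumes carrier_eq [simp]: "carrier B = UNIV"
    and circle_eq [simp]: "a \<otimes> b = a + b"
begin

lemma one_eq [simp]: "\<one> = 0"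
  using circ.l_one[of 0] by simp

lemma zero_eq [simp]: "\<zero> = 0"
  using one_eq_zero by simp

lemma inv_eq [simp]: "inv a = - a"
  by (rule circ.inv_equality) auto

lemma add_lam: "a \<oplus> lam a b = a + b"
  using circle_lam[of a b] by simp

lemma lam_plus: "lam (a + b) c = lam a (lam b c)"
  using lam_circle[of a b c] by simp

lemma lam_0 [simp]: "lam 0 b = b"
  using lam_one[of b] by simp

lemma lam_zero_right [simp]: "lam a 0 = 0"
  using add.l_inv[of a] by (simp add: lam_def)

lemma lam_uminus: "lam a (\<ominus> b) = \<ominus> lam a b"
proof -
  have "lam a (\<ominus> b) \<oplus> lam a b = 0"
    using lam_add[of a "\<ominus> b" b] add.l_inv[of b] by simp
  then show ?thesis using add.inv_equality[of "lam a (\<ominus> b)" "lam a b"] by simp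
qed

text \<open>The socle is a subgroup of the circle group, which here is (Z, +).\<close>

lemma socle_mult:
  assumes "n \<in> socle B" shows "k * n \<in> socle B"
proof -
  interpret S: subgroup "socle B" B
    using socle_ideal by (simp add: brace_ideal_def normal_def)
  have nat: "int j * n \<in> socle B" for j
    by (induction j) (use S.one_closed S.m_closed assms in \<open>auto simp: algebra_simps\<close>)
  show ?thesis
    using nat[of "nat k"] S.m_inv_closed[OF nat[of "nat (- k)"]] by (cases "k \<ge> 0") auto
qed

section \<open>Transfer to a central subgroup of finite index\<close>

lemma socle_add: "n \<in> socle B \<Longrightarrow> n \<oplus> a = n + a" "n \<in> socle B \<Longrightarrow> a \<oplus> n = n + a"
  by (simp_all add: socle_def)

lemma zero_add [simp]: "0 \<oplus> a = a" and add_zero [simp]: "a \<oplus> 0 = a"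
  using add.l_one[of a] add.r_one[of a] by simp_all

lemma add_assoc: "a \<oplus> b \<oplus> c = a \<oplus> (b \<oplus> c)"
  by (simp add: add.m_assoc)

text \<open>Since \<open>k * n\<close> is central and adding it by \<open>\<oplus>\<close> is
  ordinary addition, left additions respect congruence modulo n.\<close>

lemma socle_shift:
  assumes "n \<in> socle B" shows "a \<oplus> (k * n + b) = k * n + (a \<oplus> b)"
proof -
  have s: "k * n \<in> socle B" by (rule socle_mult[OF assms])
  have "a \<oplus> (k * n + b) = (a \<oplus> k * n) \<oplus> b"
    by (simp add: add_assoc socle_add(1)[OF s])
  also have "\<dots> = (k * n \<oplus> a) \<oplus> b" by (simp add: socle_add[OF s])
  also have "\<dots> = k * n \<oplus> (a \<oplus> b)" by (rule add_assoc)
  also have "\<dots> = k * n + (a \<oplus> b)" by (rule socle_add(1)[OF s])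
  finally show ?thesis .
qed

text \<open>For positive n in the socle this is the group-theoretic transfer into nZ, with
  representatives 0, ..., n - 1 and nZ identified with Z through division by n.\<close>

definition transfer :: "int \<Rightarrow> int \<Rightarrow> int" where
  "transfer n a = (\<Sum>r\<in>{0..<n}. (a \<oplus> r) div n)"

lemma transfer_add:
  assumes n: "n \<in> socle B" "n > 0"
  shows "transfer n (a \<oplus> b) = transfer n a + transfer n b"
proof -
  let ?s = "\<lambda>r. (b \<oplus> r) mod n"
  \<comment> \<open>Left addition of \<open>b\<close> permutes the residue classes; reindexing by
    this permutation turns the carries of \<open>a\<close> into \<open>transfer n a\<close>.\<close>
  have inj: "inj_on ?s {0..<n}"
  proof (rule inj_onI)
    fix r r' assume r: "r \<in> {0..<n}" "r' \<in> {0..<n}" and "?s r = ?s r'"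
    then obtain k where "b \<oplus> r = k * n + (b \<oplus> r')"
      by (metis add.commute mod_eqE mult.commute)
    then have "b \<oplus> r = b \<oplus> (k * n + r')" by (simp add: socle_shift[OF n(1)])
    then have "r = k * n + r'" using add.l_cancel[of b r "k * n + r'"] by simp
    then have "r mod n = r' mod n" by simp
    then show "r = r'" using r by simp
  qed
  have "?s ` {0..<n} = {0..<n}"
    by (rule endo_inj_surj[OF _ _ inj]) (use n in auto)
  with inj have bij: "bij_betw ?s {0..<n} {0..<n}" by (simp add: bij_betw_def)
  have "(a \<oplus> b \<oplus> r) div n = (b \<oplus> r) div n + (a \<oplus> ?s r) div n" for r
  proof -
    have "a \<oplus> b \<oplus> r = a \<oplus> ((b \<oplus> r) div n * n + ?s r)" by (simp add: add_assoc)
    also have "\<dots> = (b \<oplus> r) div n * n + (a \<oplus> ?s r)" by (rule socle_shift[OF n(1)])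
    finally show ?thesis using n by simp
  qed
  then have "transfer n (a \<oplus> b) = transfer n b + (\<Sum>r\<in>{0..<n}. (a \<oplus> ?s r) div n)"
    by (simp add: transfer_def sum.distrib)
  also have "(\<Sum>r\<in>{0..<n}. (a \<oplus> ?s r) div n) = transfer n a"
    unfolding transfer_def by (rule sum.reindex_bij_betw[OF bij])
  finally show ?thesis by simp
qed

lemma transfer_socle:
  assumes n: "n \<in> socle B" "n > 0"
  shows "transfer n (k * n) = k * n"
proof -
  have "(k * n \<oplus> r) div n = k" if "r \<in> {0..<n}" for r
    using n that socle_add(1)[OF socle_mult[OF n(1)]] by simp
  then have "transfer n (k * n) = (\<Sum>r\<in>{0..<n}. k)"
    unfolding transfer_def by (intro sum.cong) auto
  then show ?thesis using n by simp
qed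

theorem add_commute_if_socle_nontrivial:
  assumes n: "n \<in> socle B" "n > 0"
  shows "a \<oplus> b = b \<oplus> a"
proof -
  note F_add = transfer_add[OF n]
  have F_0: "transfer n 0 = 0" using transfer_socle[OF n, of 0] by simp
  have F_minus: "transfer n (\<ominus> x) = - transfer n x" for x
    using F_add[of "\<ominus> x" x] add.l_inv[of x] F_0 by simp
  define K where "K = {c. \<forall>a. transfer n (lam a c) = 0}"
  \<comment> \<open>Here \<open>c + d = c \<oplus> lam c d\<close>, and \<open>lam a\<close> maps
    the second summand to \<open>lam (a + c) d\<close>; hence the demand on whole orbits.\<close>
  have K_plus: "c + d \<in> K" if "c \<in> K" "d \<in> K" for c d
    using that lam_add[of _ c "lam c d"] F_add
    by (auto simp: K_def add_lam[symmetric] lam_plus[symmetric])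
  \<comment> \<open>Closure under + puts the ordinary multiple \<open>n * c\<close> in K, and the
    transfer leaves it unchanged.\<close>
  have K_trivial: "c = 0" if "c \<in> K" for c
  proof -
    have "int j * c \<in> K" for j
      by (induction j) (use that K_plus F_0 in \<open>auto simp: algebra_simps K_def\<close>)
    from this[of "nat n"] have "n * c \<in> K" using n by simp
    then have "transfer n (lam 0 (n * c)) = 0" unfolding K_def by blast
    then show "c = 0" using transfer_socle[OF n, of c] n by (simp add: mult.commute)
  qed
  \<comment> \<open>The transfer has abelian image and each \<open>lam a\<close> is additive, so
    commutators lie in K.\<close>
  have "a \<oplus> b \<oplus> \<ominus> (b \<oplus> a) \<in> K"
    by (simp add: K_def lam_add lam_uminus F_add F_minus)
  then have "a \<oplus> b \<oplus> \<ominus> (b \<oplus> a) = 0" by (rule K_trivial)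
  then show ?thesis using add.inv_solve_right'[of "\<zero>" "a \<oplus> b" "b \<oplus> a"] by simp
qed

section \<open>Additive multiples and the orbit of 1\<close>

text \<open>The element \<open>k\<close> is the \<open>k\<close>-th circle power of \<open>1\<close>; its \<open>k\<close>-th additive multiple is \<open>k \<star> 1\<close>.\<close>

abbreviation multiple :: "int \<Rightarrow> int \<Rightarrow> int" (infixr "\<star>" 75)
  where "k \<star> x \<equiv> add_pow B k x"

lemma multiple_add: "(k + l) \<star> x = k \<star> x \<oplus> l \<star> x"
  using add.int_pow_mult[of x k l] by (simp add: add_pow_def)

lemma multiple_mult: "(k * l) \<star> x = k \<star> (l \<star> x)"
  using add.int_pow_pow[of x l k] by (simp add: add_pow_def mult.commute)

lemma multiple_0 [simp]: "(0::int) \<star> x = 0"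
  by (simp add: add_pow_def)

lemma multiple_1 [simp]: "(1::int) \<star> x = x"
  using add.int_pow_1[of x] by (simp add: add_pow_def)

lemma lam_multiple: "lam a (k \<star> x) = k \<star> lam a x"
proof -
  have "lam a \<in> hom (add_monoid B) (add_monoid B)"
    by (auto simp: hom_def lam_add)
  from hom_int_pow[OF this _ additive_group additive_group, of x k]
  show ?thesis by (simp add: add_pow_def)
qed

lemma lam_inj: "lam a x = lam a y \<longleftrightarrow> x = y"
  using lam_plus[of "- a" a x] lam_plus[of "- a" a y] by auto

text \<open>By \<open>x + 1 = x \<oplus> lam x 1\<close> the orbit of 1 generates the additive
  group. As the circle group is commutative, \<open>lam N\<close> commutes with each
  \<open>lam x\<close> and so fixes this orbit pointwise.\<close>

lemma lam_fixes_all: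
  assumes "lam N 1 = 1" shows "lam N x = x"
proof (induction x rule: int_induct[where k = 0])
  have N: "lam N (lam x 1) = lam x 1" for x
    using assms lam_plus[of N x 1] lam_plus[of x N 1] by (simp add: add.commute)
  have step: "lam N (x + 1) = lam N x \<oplus> lam x 1" for x
    by (simp add: add_lam[symmetric] lam_add N)
  case base show ?case by simp
  {
    case (step1 x) then show ?case by (simp add: step add_lam)
  next
    case (step2 x)
    have "lam N (x - 1) \<oplus> lam (x - 1) 1 = (x - 1) \<oplus> lam (x - 1) 1"
      using step[of "x - 1"] step2 by (simp add: add_lam)
    then show ?case using add.r_cancel[of "lam N (x - 1)" "lam (x - 1) 1" "x - 1"] by simp
  }
qed

lemma lam_power:
  assumes "u \<star> 1 = lam a 1" shows "(u ^ k) \<star> 1 = lam (a * int k) 1"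
proof (induction k)
  case (Suc k)
  have "(u ^ Suc k) \<star> 1 = (u ^ k) \<star> lam a 1"
    by (simp add: multiple_mult assms[symmetric] flip: multiple_mult) (simp add: mult.commute)
  also have "\<dots> = lam a (lam (a * int k) 1)" by (simp add: Suc lam_multiple[symmetric])
  finally show ?case by (simp add: lam_plus[symmetric] algebra_simps)
qed simp

end

section \<open>Abelian additive group: the submodule (1 - T) R\<close>

locale abelian_integer_brace = integer_brace +
  assumes add_commute: "a \<oplus> b = b \<oplus> a"
begin

sublocale ab: ab_group_add "(\<oplus>)" "0" "\<lambda>a b. a \<ominus> b" "a_inv B"
  by unfold_locales
    (use add_commute add_assoc add.l_inv in \<open>auto simp: a_minus_def\<close>)

lemmas ab_simps = ab.add.assoc ab.add.commute ab.add.left_commute ab.diff_diff_add ab.diff_diff_eq2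
  ab.add_diff_eq ab.diff_add_eq ab.diff_eq_eq ab.eq_diff_eq

lemma add_eq_plus_if_fixes_one:
  assumes "lam 1 1 = 1" shows "a \<oplus> b = a + b"
proof -
  have f: "lam 1 x = x" for x using lam_fixes_all[OF assms] .
  have "lam a 1 = 1"
  proof (induction a rule: int_induct[where k = 0])
    case (step1 a) then show ?case by (simp add: lam_plus f)
  next
    case (step2 a) then show ?case using lam_plus[of 1 "a - 1" 1] by (simp add: f)
  qed simp
  from lam_fixes_all[OF this, of b] add_lam[of a b] show ?thesis by simp
qed

text \<open>In terms of \<open>T = lam 1\<close>: \<open>1 - (1 - T) r = T\<^sup>r 1\<close>.\<close>

lemma add_lam_swap: "r \<oplus> lam r 1 = 1 \<oplus> lam 1 r"
  by (simp add: add_lam add.commute)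

text \<open>This is (1 - T) R, the product of R with the augmentation ideal of Z[T, T^(-1)]; modulo
  it T acts trivially.\<close>

definition augmentation :: "int set" where
  "augmentation = range (\<lambda>r. r \<ominus> lam 1 r)"

lemma augmentation_lam:
  assumes "c \<in> augmentation" shows "\<exists>n. 1 \<ominus> c = lam n 1"
proof -
  obtain r where "c = r \<ominus> lam 1 r" using assms by (auto simp: augmentation_def)
  then have "1 \<ominus> c = (1 \<oplus> lam 1 r) \<ominus> r" by (simp add: ab.diff_diff_eq2)
  also have "\<dots> = lam r 1" by (simp add: add_lam_swap[symmetric])
  finally have "1 \<ominus> c = lam r 1" .
  then show ?thesis by blast
qed

lemma augmentation_iff: "c \<in> augmentation \<longleftrightarrow> (\<exists>r. c \<oplus> lam 1 r = r)"
  by (auto simp: augmentation_def image_iff ab.eq_diff_eq)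

lemma multiple_add_right: "k \<star> (x \<oplus> y) = k \<star> x \<oplus> k \<star> y"
proof -
  interpret C: comm_group "add_monoid B"
    by (rule group.group_comm_groupI[OF additive_group]) (simp add: add_commute)
  show ?thesis using C.int_pow_distrib[of x y k] by (simp add: add_pow_def)
qed

lemma multiple_minus: "(- k) \<star> x = \<ominus> (k \<star> x)"
  using add.int_pow_neg[of x k] by (simp add: add_pow_def)

lemma augmentation_multiple:
  assumes "c \<in> augmentation" shows "k \<star> c \<in> augmentation"
proof -
  obtain r where "c \<oplus> lam 1 r = r" using assms by (auto simp: augmentation_iff)
  then have "k \<star> c \<oplus> lam 1 (k \<star> r) = k \<star> r" by (metis multiple_add_right lam_multiple)
  then show ?thesis by (auto simp: augmentation_iff)
qed

lemma augmentation_add: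
  assumes "c \<in> augmentation" "d \<in> augmentation" shows "c \<oplus> d \<in> augmentation"
proof -
  obtain r s where "c \<oplus> lam 1 r = r" "d \<oplus> lam 1 s = s" using assms by (auto simp: augmentation_iff)
  then have "(c \<oplus> d) \<oplus> lam 1 (r \<oplus> s) = r \<oplus> s"
    by (metis lam_add carrier_eq UNIV_I ab.add.assoc ab.add.commute)
  then show ?thesis by (auto simp: augmentation_iff)
qed

lemma augmentation_minus: "c \<in> augmentation \<Longrightarrow> \<ominus> c \<in> augmentation"
  using augmentation_multiple[of c "-1"] by (simp add: multiple_minus)

text \<open>Modulo (1 - T) R, the integer \<open>n + 1 = 1 \<oplus> lam 1 n\<close> is congruent to
  \<open>1 \<oplus> n\<close>, so one copy of 1 is added at each step.\<close>

lemma cong_multiple_one: "n \<ominus> n \<star> 1 \<in> augmentation"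
proof (induction n rule: int_induct[where k = 0])
  have step: "(n + 1) \<ominus> (n + 1) \<star> 1 = (n \<ominus> n \<star> 1) \<oplus> \<ominus> (n \<ominus> lam 1 n)" for n
    using add_lam[of 1 n] by (simp add: multiple_add add.commute[of n 1] ab_simps)
  have d: "n \<ominus> lam 1 n \<in> augmentation" for n by (auto simp: augmentation_def)
  case base show ?case using d[of 0] by simp
  {
    case (step1 n) then show ?case
      unfolding step by (intro augmentation_add augmentation_minus d)
  next
    case (step2 n)
    have "(n - 1) \<ominus> (n - 1) \<star> 1 = (n \<ominus> n \<star> 1) \<oplus> ((n - 1) \<ominus> lam 1 (n - 1))"
      by (metis step diff_add_cancel ab.add.assoc ab.left_minus add_zero)
    then show ?case using augmentation_add[OF step2(2) d[of "n - 1"]] by simp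
  }
qed

text \<open>The integer \<open>1 \<oplus> 1\<close> equals \<open>2 \<star> 1\<close> and is
  congruent to \<open>(1 \<oplus> 1) \<star> 1\<close>. The difference of the two multipliers gives
  d up to sign; it vanishes only if \<open>lam 1 1 = 1\<close>.\<close>

lemma fixes_one_or_torsion_mod:
  obtains "lam 1 1 = 1" | d where "d > 0" "d \<star> 1 \<in> augmentation"
proof -
  define n where "n = 1 \<oplus> 1"
  have 2: "n = 2 \<star> 1" using multiple_add[of 1 1 1] by (simp add: n_def)
  have "2 \<star> 1 \<ominus> n \<star> 1 \<in> augmentation" using cong_multiple_one[of n] 2 by simp
  then have J: "(2 - n) \<star> 1 \<in> augmentation"
    using multiple_add[of 2 "- n" 1] by (simp add: multiple_minus)
  then have J': "(n - 2) \<star> 1 \<in> augmentation"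
    using augmentation_minus[OF J] multiple_minus[of "2 - n" 1] by simp
  consider "n = 2" | "n - 2 > 0" | "2 - n > 0" by linarith
  then show ?thesis
  proof cases
    case 1
    then have "1 \<oplus> 1 = 1 \<oplus> lam 1 1" using add_lam[of 1 1] by (simp add: n_def)
    then show ?thesis using that(1) add.l_cancel[of 1 1 "lam 1 1"] by simp
  qed (use J J' that in blast)+
qed

section \<open>Positive characteristic\<close>

text \<open>Both \<open>1 + d\<close> and \<open>1 + 2 * d\<close> act on 1 as powers of T. Suitable
  powers of them act as equal or as inverse powers of T, so their difference, or their product minus
  1, kills 1.\<close>

lemma torsion_one:
  assumes d: "d > 0" "d \<star> 1 \<in> augmentation"
  obtains m where "m > 0" "m \<star> 1 = 0"
proof -
  have power: "\<exists>a. (1 + k * d) \<star> 1 = lam a 1" for k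
    using augmentation_lam[OF augmentation_multiple[OF d(2), of "- k"]]
      multiple_mult[of "- k" d 1] multiple_add[of 1 "k * d" 1]
    by (simp add: multiple_minus)
  obtain a b where a: "(1 + d) \<star> 1 = lam a 1" and b: "(1 + 2 * d) \<star> 1 = lam b 1"
    using power[of 1] power[of 2] by auto
  have "\<exists>m. m \<noteq> 0 \<and> m \<star> 1 = 0"
  proof (cases "a = 0")
    case True
    then have "d \<star> 1 = 0" using a multiple_add[of 1 d 1] by simp
    then show ?thesis using d(1) by (intro exI[of _ d]) simp
  next
    case False
    \<comment> \<open>With these exponents the powers of T are a|b| and b|a|, equal up to
      sign.\<close>
    define K L where "K = nat \<bar>b\<bar>" and "L = nat \<bar>a\<bar>"
    let ?u = "(1 + d) ^ K" and ?v = "(1 + 2 * d) ^ L"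
    have u: "?u \<star> 1 = lam (a * K) 1" and v: "?v \<star> 1 = lam (b * L) 1"
      using lam_power a b by auto
    have v1: "?v > 1" using False d by (simp add: L_def one_less_power)
    have "a * \<bar>b\<bar> = b * \<bar>a\<bar> \<or> a * \<bar>b\<bar> = - (b * \<bar>a\<bar>)" by (simp add: abs_if)
    then consider "a * K = b * L" | "a * K = - (b * L)" by (auto simp: K_def L_def)
    then show ?thesis
    proof cases
      case 1
      then have "(?u - ?v) \<star> 1 = 0"
        using u v multiple_add[of ?u "- ?v" 1] by (simp add: multiple_minus)
      moreover have "coprime (1 + d) (1 + 2 * d)"
      proof -
        have "(1 + d) * 2 - (1 + 2 * d) = 1" by simp
        then show ?thesis by (metis coprimeI dvd_diff dvd_mult2)
      qed
      then have coprime: "coprime ?u ?v" by simp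
      \<comment> \<open>Coprime integers coincide only if they are units, which \<open>v1\<close>
        excludes.\<close>
      have "?u \<noteq> ?v"
      proof
        assume "?u = ?v"
        then have "?v dvd 1" using coprime by (metis coprime_self)
        then show False using v1 zdvd_imp_le by fastforce
      qed
      ultimately show ?thesis by (intro exI[of _ "?u - ?v"]) simp
    next
      case 2
      have "(?u * ?v) \<star> 1 = lam (b * L) (lam (a * K) 1)"
        using u v by (simp add: multiple_mult lam_multiple[symmetric])
      also have "\<dots> = 1" using 2 by (simp flip: lam_plus)
      finally have "(?u * ?v - 1) \<star> 1 = 0"
        using multiple_add[of "?u * ?v" "- 1" 1] by (simp add: multiple_minus)
      moreover have "?u * ?v > 1"
        using v1 d(1) mult_right_mono[of 1 ?u ?v] one_le_power[of "1 + d" K] by linarith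
      ultimately show ?thesis by (intro exI[of _ "?u * ?v - 1"]) simp
    qed
  qed
  then obtain m where m: "m \<noteq> 0" "m \<star> 1 = 0" by blast
  then show ?thesis using that[of "\<bar>m\<bar>"] multiple_minus[of m 1] by (cases "m > 0") (auto simp: abs_if)
qed

section \<open>Finite spans of powers of T against the infinite order of T\<close>

text \<open>By \<open>x + 1 = 1 \<oplus> lam 1 x\<close> the element 1 generates R under T, and
  additive multiples commute with T.\<close>

lemma torsion_all:
  assumes m: "m \<star> 1 = 0" shows "m \<star> x = 0"
proof (induction x rule: int_induct[where k = 0])
  have step: "m \<star> (x + 1) = lam 1 (m \<star> x)" for x
    using m multiple_add_right[of m 1 "lam 1 x"] by (simp add: add_lam add.commute lam_multiple)
  case base show ?case using add.int_pow_one by (simp add: add_pow_def)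
  {
    case (step1 x) then show ?case by (simp add: step)
  next
    case (step2 x)
    then have "lam 1 (m \<star> (x - 1)) = lam 1 0" using step[of "x - 1"] by simp
    then show ?case by (simp only: lam_inj)
  }
qed

text \<open>If T^N fixes 1, it is the identity, so \<open>N \<oplus> int k * N\<close> is an
  ordinary sum and both kinds of multiples of N agree. Torsion then gives
  \<open>m * N = 0\<close>.\<close>

lemma infinite_order:
  assumes m: "m > 0" "m \<star> 1 = 0" and N: "lam N 1 = 1" shows "N = 0"
proof -
  have "int k * N = int k \<star> N" for k
  proof (induction k)
    case (Suc k)
    have "int (Suc k) * N = N \<oplus> lam N (int k * N)" by (simp add: add_lam algebra_simps)
    also have "\<dots> = int (Suc k) \<star> N"
      using Suc multiple_add[of 1 "int k" N] by (simp add: lam_fixes_all[OF N])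
    finally show ?case .
  qed simp
  from this[of "nat m"] have "m * N = 0" using m torsion_all by simp
  then show ?thesis using m by simp
qed

text \<open>The Z-span of 1, T 1, ..., T^(k-1) 1, with generators split off singly for
  induction.\<close>

primrec orbit_span :: "nat \<Rightarrow> int set" where
  "orbit_span 0 = {0}"
| "orbit_span (Suc k) = {c \<star> lam (int k) 1 \<oplus> y | c y. y \<in> orbit_span k}"

lemma orbit_span_finite:
  assumes m: "m > 0" "m \<star> 1 = 0" shows "finite (orbit_span k)"
proof (induction k)
  case (Suc k)
  have reduce: "c \<star> x = (c mod m) \<star> x" for c x
    using multiple_add[of "m * (c div m)" "c mod m" x] torsion_all[OF m(2)]
    by (simp add: multiple_mult)
  have "orbit_span (Suc k) \<subseteq> (\<lambda>(c, y). c \<star> lam (int k) 1 \<oplus> y) ` ({0..<m} \<times> orbit_span k)"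
  proof
    fix x assume "x \<in> orbit_span (Suc k)"
    then obtain c y where "x = c \<star> lam (int k) 1 \<oplus> y" "y \<in> orbit_span k" by auto
    then show "x \<in> (\<lambda>(c, y). c \<star> lam (int k) 1 \<oplus> y) ` ({0..<m} \<times> orbit_span k)"
      using reduce[of c "lam (int k) 1"] m(1) by (intro image_eqI[of _ _ "(c mod m, y)"]) simp_all
  qed
  then show ?case using Suc by (meson finite_SigmaI finite_atLeastLessThan_int finite_imageI finite_subset)
qed simp

lemma orbit_span_zero: "0 \<in> orbit_span k"
  by (induction k) (auto intro!: exI[of _ "0::int"])

lemma orbit_span_Suc: "x \<in> orbit_span k \<Longrightarrow> x \<in> orbit_span (Suc k)"
  by (simp, intro exI[of _ "0::int"] exI[of _ x]) simp

lemma orbit_span_mono: "k \<le> l \<Longrightarrow> x \<in> orbit_span k \<Longrightarrow> x \<in> orbit_span l"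
  by (induction l rule: dec_induct) (auto simp del: orbit_span.simps intro: orbit_span_Suc)

lemma orbit_span_base:
  assumes "i < k" shows "lam (int i) 1 \<in> orbit_span k"
proof (rule orbit_span_mono)
  have "1 \<star> lam (int i) 1 \<oplus> 0 \<in> orbit_span (Suc i)"
    unfolding orbit_span.simps using orbit_span_zero by blast
  then show "lam (int i) 1 \<in> orbit_span (Suc i)" by (simp del: orbit_span.simps)
qed (use assms in simp)

lemma orbit_span_add: "x \<in> orbit_span k \<Longrightarrow> y \<in> orbit_span k \<Longrightarrow> x \<oplus> y \<in> orbit_span k"
proof (induction k arbitrary: x y)
  case (Suc k)
  then obtain c d u v where "x = c \<star> lam (int k) 1 \<oplus> u" "y = d \<star> lam (int k) 1 \<oplus> v"
    and uv: "u \<in> orbit_span k" "v \<in> orbit_span k" by auto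
  then have "x \<oplus> y = (c + d) \<star> lam (int k) 1 \<oplus> (u \<oplus> v)"
    by (simp add: multiple_add ab.add.assoc ab.add.left_commute)
  then show ?case using Suc.IH[OF uv] by auto
qed simp

lemma orbit_span_multiple: "x \<in> orbit_span k \<Longrightarrow> c \<star> x \<in> orbit_span k"
proof (induction k arbitrary: x)
  case 0 then show ?case using add.int_pow_one by (simp add: add_pow_def)
next
  case (Suc k)
  then obtain d u where "x = d \<star> lam (int k) 1 \<oplus> u" and u: "u \<in> orbit_span k" by auto
  then have "c \<star> x = (c * d) \<star> lam (int k) 1 \<oplus> c \<star> u"
    by (simp add: multiple_mult multiple_add_right)
  then show ?case using Suc.IH[OF u] by auto
qed

lemma orbit_span_diff: "x \<in> orbit_span k \<Longrightarrow> y \<in> orbit_span k \<Longrightarrow> x \<ominus> y \<in> orbit_span k"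
  using orbit_span_add[of x k "\<ominus> y"] orbit_span_multiple[of y k "- 1"]
  by (simp add: multiple_minus)

lemma orbit_span_lam: "x \<in> orbit_span k \<Longrightarrow> lam 1 x \<in> orbit_span (Suc k)"
proof (induction k arbitrary: x)
  case 0 then show ?case using orbit_span_zero[of "Suc 0"] by simp
next
  case (Suc k)
  then obtain d u where "x = d \<star> lam (int k) 1 \<oplus> u" and u: "u \<in> orbit_span k" by auto
  then have "lam 1 x = d \<star> lam (int (Suc k)) 1 \<oplus> lam 1 u"
    using lam_plus[of 1 "int k" 1] by (simp add: lam_add lam_multiple)
  then show ?case using Suc.IH[OF u] by auto
qed

text \<open>Otherwise this finite span would be stable under T and contain every
  \<open>lam (int i) 1\<close>; two of these would coincide, so a nonzero power of T would fix
  1.\<close>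

lemma orbit_span_not_closed:
  assumes m: "m > 0" "m \<star> 1 = 0" and D: "D > 0"
  shows "lam (int D) 1 \<notin> orbit_span D"
proof
  assume mem: "lam (int D) 1 \<in> orbit_span D"
  have sub: "x \<in> orbit_span D" if "x \<in> orbit_span (Suc D)" for x
    using that mem by (auto intro: orbit_span_add orbit_span_multiple)
  have "lam (int i) 1 \<in> orbit_span D" for i
  proof (induction i)
    case 0 then show ?case using orbit_span_base[OF D] by simp
  next
    case (Suc i) then show ?case using sub[OF orbit_span_lam] lam_plus[of 1 "int i" 1] by simp
  qed
  then have "finite (range (\<lambda>i. lam (int i) 1))"
    by (meson finite_subset image_subsetI orbit_span_finite[OF m])
  then have "\<not> inj (\<lambda>i. lam (int i) 1)" using finite_imageD infinite_UNIV_nat by blast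
  then obtain i j :: nat where ij: "lam (int i) 1 = lam (int j) 1" "i \<noteq> j" by (auto simp: inj_def)
  then have "lam (int j - int i) 1 = 1"
    using lam_plus[of "- int i" "int i" 1] lam_plus[of "- int i" "int j" 1] by simp
  then show False using infinite_order[OF m] ij(2) by fastforce
qed

text \<open>On 1, \<open>add_lam_swap\<close> at n = T 1 reads T + T^n = 1 + T^2. Either the highest
  power can be isolated, against \<open>orbit_span_not_closed\<close>, or terms cancel and T fixes
  1.\<close>

lemma not_torsion:
  assumes m: "m > 0" "m \<star> 1 = 0" shows False
proof -
  define n where "n = lam 1 1"
  have rel: "lam (k + 1) 1 \<oplus> lam (k + n) 1 = lam k 1 \<oplus> lam (k + 2) 1" for k
  proof -
    have "lam 1 1 \<oplus> lam n 1 = 1 \<oplus> lam 2 1"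
      using add_lam_swap[of n] lam_plus[of 1 1 1] by (simp add: n_def)
    then have "lam k (lam 1 1 \<oplus> lam n 1) = lam k (1 \<oplus> lam 2 1)" by simp
    then show ?thesis by (simp add: lam_add lam_plus)
  qed
  have not_fixed: "lam 1 1 \<noteq> 1" using infinite_order[OF m, of 1] by auto
  consider "n < 0" | "n = 0" | "n = 1" | "n = 2" | "n > 2" by linarith
  then show False
  proof cases
    case 1
    \<comment> \<open>The shift by -n gives the exponents \<open>k + 1\<close>, 0, \<open>k\<close>
      and \<open>k + 2\<close>, all nonnegative.\<close>
    define k where "k = nat (- n)"
    have "lam (int (k + 2)) 1 = lam (int (k + 1)) 1 \<oplus> lam (int 0) 1 \<ominus> lam (int k) 1"
      using rel[of "- n"] 1 by (simp add: k_def ab.eq_diff_eq ab.add.commute algebra_simps)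
    moreover have "\<dots> \<in> orbit_span (k + 2)"
      by (intro orbit_span_add orbit_span_diff orbit_span_base) auto
    ultimately show False using orbit_span_not_closed[OF m, of "k + 2"] by simp
  next
    case 2
    then have "lam 1 1 = lam 1 (lam 1 1)"
      using rel[of 0] lam_plus[of 1 1 1] ab.add.commute by simp
    then show False using lam_inj[of 1 1 "lam 1 1"] not_fixed by metis
  next
    case 3
    then have "lam (int 2) 1 = lam (int 1) 1 \<oplus> lam (int 1) 1 \<ominus> lam (int 0) 1"
      using rel[of 0] by (simp add: ab.eq_diff_eq ab.add.commute)
    moreover have "\<dots> \<in> orbit_span 2"
      by (intro orbit_span_add orbit_span_diff orbit_span_base) auto
    ultimately show False using orbit_span_not_closed[OF m, of 2] by simp
  next
    case 4
    then show False using rel[of 0] not_fixed by simp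
  next
    case 5
    define k where "k = nat n"
    have "lam (int k) 1 = lam (int 0) 1 \<oplus> lam (int 2) 1 \<ominus> lam (int 1) 1"
      using rel[of 0] 5 by (simp add: k_def ab.eq_diff_eq ab.add.commute)
    moreover have "\<dots> \<in> orbit_span k"
      by (intro orbit_span_add orbit_span_diff orbit_span_base) (use 5 in \<open>auto simp: k_def\<close>)
    ultimately show False using orbit_span_not_closed[OF m, of k] 5 by (simp add: k_def)
  qed
qed

theorem add_eq_plus: "a \<oplus> b = a + b"
proof (cases rule: fixes_one_or_torsion_mod)
  case 1 then show ?thesis by (simp add: add_eq_plus_if_fixes_one)
next
  case (2 d)
  then obtain m where "m > 0" "m \<star> 1 = 0" by (rule torsion_one)
  then show ?thesis using not_torsion by blast
qed

end

section \<open>Isomorphism invariance and the socle series\<close>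

context skew_left_brace begin

lemma ring_iso_socle:
  assumes B: "skew_left_brace B" and f: "f \<in> ring_iso A B"
  shows "socle B = f ` socle A"
proof -
  interpret B: skew_left_brace B by fact
  note f = ring_iso_memE[OF f]
  have surj: "carrier B = f ` carrier A" and inj: "inj_on f (carrier A)"
    using f(5) by (auto simp: bij_betw_def)
  have iff: "f x \<in> socle B \<longleftrightarrow> x \<in> socle A" if x: "x \<in> carrier A" for x
    using x inj by (simp add: socle_def surj f(2,3)[symmetric] inj_on_eq_iff)
  show ?thesis
  proof (intro equalityI subsetI)
    fix y assume y: "y \<in> socle B"
    then have "y \<in> carrier B" by (simp add: B.socle_iff)
    then obtain x where "x \<in> carrier A" "y = f x" using surj by auto
    then show "y \<in> f ` socle A" using iff y by simp
  next
    fix y assume "y \<in> f ` socle A"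
    then obtain x where "x \<in> socle A" "y = f x" by auto
    then show "y \<in> socle B" using iff by (simp add: socle_iff)
  qed
qed

lemma ring_iso_Quot_zero: "(\<lambda>x. {\<zero>} +> x) \<in> ring_iso A (A Quot {\<zero>})"
  if ideal: "brace_ideal {\<zero>} A"
proof (rule ring_iso_memI)
  interpret N: normal "{\<zero>}" "add_monoid A" using ideal by (simp add: brace_ideal_def)
  have single: "{\<zero>} +> x = {x}" if "x \<in> carrier A" for x
    using that by (simp add: a_r_coset_def r_coset_def)
  show bij: "bij_betw (\<lambda>x. {\<zero>} +> x) (carrier A) (carrier (A Quot {\<zero>}))"
    by (auto simp: bij_betw_def inj_on_def single FactRing_def A_RCOSETS_def RCOSETS_def
        a_r_coset_def[symmetric])
  show "{\<zero>} +> x \<in> carrier (A Quot {\<zero>})" if "x \<in> carrier A" for x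
    using bij that by (auto simp: bij_betw_def)
  show "{\<zero>} +> \<one> = \<one>\<^bsub>A Quot {\<zero>}\<^esub>" by (simp add: FactRing_def)
  fix x y assume c: "x \<in> carrier A" "y \<in> carrier A"
  show "{\<zero>} +> (x \<oplus> y) = ({\<zero>} +> x) \<oplus>\<^bsub>A Quot {\<zero>}\<^esub> ({\<zero>} +> y)"
    using c N.rcos_sum[of x y] by (simp add: FactRing_def a_r_coset_def set_add_def)
  show "{\<zero>} +> (x \<otimes> y) = ({\<zero>} +> x) \<otimes>\<^bsub>A Quot {\<zero>}\<^esub> ({\<zero>} +> y)"
    using c ideal by (simp add: FactRing_def coset_circle)
qed

end

text \<open>Cosets of the zero ideal are singletons, so each quotient step yields an isomorphic
  copy, whose socle is again zero.\<close>

lemma socle_series_iso: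
  assumes A: "skew_left_brace A" and socle: "socle A = {\<zero>\<^bsub>A\<^esub>}"
  shows "\<exists>f. f \<in> ring_iso A (socle_series A n)"
proof (induction n)
  case 0 show ?case using ring_iso_set_refl by auto
next
  case (Suc n)
  then obtain f where f: "f \<in> ring_iso A (socle_series A n)" by blast
  interpret A: skew_left_brace A by fact
  interpret S: skew_left_brace "socle_series A n" by (rule socle_series_brace[OF A])
  have "socle (socle_series A n) = {f \<zero>\<^bsub>A\<^esub>}"
    using A.ring_iso_socle[OF S.skew_left_brace_axioms f] socle by simp
  then have soc: "socle (socle_series A n) = {\<zero>\<^bsub>socle_series A n\<^esub>}"
    using subgroup.one_closed[OF S.socle_subgroup_add] by simp
  show ?case
    using ring_iso_set_trans[OF ring_iso_set_trans[OF f S.ring_iso_Quot_zero]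
        socle_quotient_iso(2)[OF S.skew_left_brace_axioms, unfolded soc]] S.socle_ideal
    by (auto simp: soc)
qed

lemma finite_multipermutation_level_socle:
  assumes A: "skew_left_brace A" and "finite_multipermutation_level A"
    and socle: "socle A = {\<zero>\<^bsub>A\<^esub>}"
  shows "\<exists>x. carrier A = {x}"
proof -
  obtain n where n: "carrier (socle_series A n) = {\<zero>\<^bsub>socle_series A n\<^esub>}"
    using assms(2) by (auto simp: finite_multipermutation_level_def)
  obtain f where "f \<in> ring_iso A (socle_series A n)" using socle_series_iso[OF A socle] by blast
  then have "bij_betw f (carrier A) (carrier (socle_series A n))" by (rule ring_iso_memE)
  then have "card (carrier A) = 1" using bij_betw_same_card n by fastforce
  then show ?thesis by (simp add: card_1_singleton_iff)
qed

lemma finite_multipermutation_level_trivial: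
  assumes A: "skew_left_brace A" and socle: "socle A = carrier A"
  shows "finite_multipermutation_level A"
proof -
  interpret A: skew_left_brace A by fact
  interpret S: skew_left_brace "socle_quotient A" by (rule socle_quotient_iso(1)[OF A])
  have bij: "bij_betw (\<lambda>K. SOME x. x \<in> K) (carrier (A Quot carrier A)) (carrier (socle_quotient A))"
    using ring_iso_memE(5)[OF socle_quotient_iso(2)[OF A]] socle by simp
  have coset: "carrier A +>\<^bsub>A\<^esub> x = carrier A" if "x \<in> carrier A" for x
    using A.add.coset_join2[OF _ A.add.subgroup_self] that by (simp add: a_r_coset_def)
  have "carrier (A Quot carrier A) \<subseteq> {carrier A}"
    using coset by (auto simp: FactRing_def A_RCOSETS_def RCOSETS_def a_r_coset_def)
  then have "carrier (socle_quotient A) \<subseteq> {SOME x. x \<in> carrier A}"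
    using bij by (auto simp: bij_betw_def)
  then have "carrier (socle_quotient A) = {\<zero>\<^bsub>socle_quotient A\<^esub>}"
    using S.add.one_closed by (metis empty_iff subset_singletonD singletonD)
  \<comment> \<open>Index 1 is the first quotient, since the series has A itself at index 0.\<close>
  then show ?thesis
    unfolding finite_multipermutation_level_def by (intro exI[of _ 1]) simp
qed

section \<open>Transport to the integers and conclusion\<close>

lemma integer_braceE:
  assumes A: "skew_left_brace A" and "A \<cong> integer_group"
  obtains B f where "integer_brace B" "f \<in> ring_iso A B"
proof -
  interpret A: skew_left_brace A by fact
  obtain f where hom: "f \<in> hom A integer_group" and bij: "bij_betw f (carrier A) UNIV"
    using assms(2) by (auto simp: is_iso_def iso_def)
  let ?g = "inv_into (carrier A) f"
  \<comment> \<open>Only the circle operation is prescribed on Z; the addition is pulled along f,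
    and its zero is identified with 0 later, by \<open>zero_eq\<close>.\<close>
  define B :: "int ring" where "B = \<lparr>carrier = UNIV, monoid.mult = (+), one = 0, ring.zero = f \<zero>\<^bsub>A\<^esub>,
    ring.add = \<lambda>i j. f (?g i \<oplus>\<^bsub>A\<^esub> ?g j)\<rparr>"
  have g: "?g (f x) = x" if "x \<in> carrier A" for x
    using bij that by (simp add: bij_betw_def)
  have mult: "f (x \<otimes>\<^bsub>A\<^esub> y) = f x + f y" if "x \<in> carrier A" "y \<in> carrier A" for x y
    using hom_mult[OF hom that] by simp
  have one: "f \<one>\<^bsub>A\<^esub> = 0"
    using mult[of "\<one>\<^bsub>A\<^esub>" "\<one>\<^bsub>A\<^esub>"] by simp
  have "skew_left_brace B"
    by (rule A.skew_left_brace_imageI[of f]) (use bij in \<open>auto simp: B_def g mult one bij_betw_def\<close>)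
  then have "integer_brace B"
    by (rule integer_brace.intro) (unfold_locales, auto simp: B_def)
  moreover have "f \<in> ring_iso A B"
    by (rule ring_iso_memI) (use bij in \<open>auto simp: B_def g mult one\<close>)
  ultimately show thesis by (rule that)
qed

theorem theorem5p6:
  fixes A :: "'a ring"
  assumes "skew_left_brace A"
    and "A \<cong> integer_group"
  shows "finite_multipermutation_level A \<longleftrightarrow> abelian_type A"
proof -
  interpret A: skew_left_brace A by fact
  obtain B f where B: "integer_brace B" and f: "f \<in> ring_iso A B"
    using integer_braceE[OF assms] .
  interpret B: integer_brace B by fact
  have bij: "bij_betw f (carrier A) UNIV" using ring_iso_memE(5)[OF f] by simp
  have inj: "f x = f y \<longleftrightarrow> x = y" if "x \<in> carrier A" "y \<in> carrier A" for x y
    using bij that by (auto simp: bij_betw_def inj_on_def)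
  have range: "\<exists>x \<in> carrier A. i = f x" for i
    using bij by (auto simp: bij_betw_def)
  have socle: "socle B = f ` socle A"
    by (rule A.ring_iso_socle[OF B.skew_left_brace_axioms f])
  have comm: "abelian_type A \<longleftrightarrow> (\<forall>x \<in> carrier A. \<forall>y \<in> carrier A. x \<oplus>\<^bsub>A\<^esub> y = y \<oplus>\<^bsub>A\<^esub> x)"
    unfolding abelian_type_def
    using group.group_comm_groupI[OF A.additive_group] comm_groupE(4)[of "add_monoid A"] by fastforce
  show ?thesis
  proof
    assume level: "finite_multipermutation_level A"
    \<comment> \<open>The carrier is infinite, whereas finite level with zero socle would force a
      singleton.\<close>
    have "\<not> (\<exists>x. carrier A = {x})"
      using bij infinite_UNIV_int bij_betw_finite by fastforce
    then have "socle A \<noteq> {\<zero>\<^bsub>A\<^esub>}"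
      using finite_multipermutation_level_socle[OF assms(1) level] by blast
    moreover have "\<zero>\<^bsub>A\<^esub> \<in> socle A"
      using subgroup.one_closed[OF A.socle_subgroup_add] by simp
    ultimately obtain x y where "x \<in> socle A" "y \<in> socle A" "x \<noteq> y" by blast
    then have "f x \<in> socle B" "f y \<in> socle B" "f x \<noteq> f y"
      using socle inj by (auto simp: socle_def)
    then obtain n where "n \<in> socle B" "n \<noteq> 0" by metis
    then have "\<bar>n\<bar> \<in> socle B" "\<bar>n\<bar> > 0"
      using B.socle_mult[of n "sgn n"] by (auto simp: sgn_if abs_if)
    note B_comm = B.add_commute_if_socle_nontrivial[OF this]
    show "abelian_type A"
      unfolding comm by (metis A.add.m_closed B_comm inj ring_iso_memE(3)[OF f])
  next
    assume "abelian_type A"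
    then have "abelian_integer_brace B"
      unfolding comm by unfold_locales (metis range ring_iso_memE(3)[OF f])
    then interpret B: abelian_integer_brace B .
    have full: "socle B = UNIV"
      using B.add_eq_plus B.add_commute by (auto simp: socle_def)
    have "x \<in> socle A" if x: "x \<in> carrier A" for x
    proof -
      have "f x \<in> f ` socle A" unfolding socle[symmetric] full by (rule UNIV_I)
      then obtain y where "y \<in> socle A" "f x = f y" by (rule imageE)
      then show ?thesis using inj[OF x, of y] by (simp add: A.socle_iff)
    qed
    then have "socle A = carrier A" by (auto simp: A.socle_iff)
    then show "finite_multipermutation_level A"
      by (rule finite_multipermutation_level_trivial[OF assms(1)])
  qed
qed

end
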